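(* There exists a setting (with pairwise distinct budgets) in which the budget-conscious by price second-price auction (BCP) has no pure Nash equilibrium, where each player's strategy is a pair (value-bid, budget-bid).
   Context: Setting: there are $k\ge 1$ slots with public click-through rates $\theta_1>\theta_2>\dots>\theta_k>0$, and $n\ge k$ players. Player $i$ has a private value per click $v_i\ge 0$ and a budget $B_i>0$; the budgets $B_1,\dots,B_n$ are pairwise distinct. A setting consists of $k,n,(\theta_j),(v_i),(B_i)$ together with a fixed strict priority order on the players used to break all ties. Each player $i$ submits a value-bid $b_i\ge 0$ and a budget-bid $g_i\ge 0$; a mechanism outputs an injective partial slot assignment (assigned player $i$ gets slot $s(i)\in\{1,\dots,k\}$) and a price per click $p(i)\ge0$ for each assigned player; unassigned players pay nothing. The utility of player $i$ is $u_i=0$ if $i$ is unassigned, $u_i=\theta_{s(i)}(v_i-p(i))$ if $i$ is assigned and $\theta_{s(i)}p(i)\le B_i$, and $u_i=-\infty$ if $i$ is assigned and $\theta_{s(i)}p(i)>B_i$. A (pure) Nash equilibrium is a profile $(b_i,g_i)_{i}$ such that no player $i$ can strictly increase $u_i$ by unilaterally replacing $(b_i,g_i)$ with any other pair. BCP: order the players by decreasing value-bid (ties broken by the priority order); each player's tentative price per click is the value-bid of the player immediately after him in this order (0 for the last player). Then process the players in this order; each player $i$ is assigned the highest-CTR slot $s$ not yet assigned such that $\theta_s\cdot(\text{his price})\le g_i$, and pays that price per click; if no unassigned slot satisfies this, he is left unassigned and pays nothing. *)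

theory Defs
  imports Complex_Main "HOL-Library.Extended_Real"
begin

text \<open>Players are 0..<n, slots are 0..<k (slot s has CTR th s; slot 0 is the best).
  The priority order is given by an injective rank function pr on the players:
  player i has priority over player j iff pr i < pr j.
  A bid profile is given by value-bids b and budget-bids g (functions on players).\<close>

definition valid_setting ::
  "nat \<Rightarrow> nat \<Rightarrow> (nat \<Rightarrow> real) \<Rightarrow> (nat \<Rightarrow> real) \<Rightarrow> (nat \<Rightarrow> real) \<Rightarrow> (nat \<Rightarrow> nat) \<Rightarrow> bool" where
  "valid_setting k n th v B pr \<longleftrightarrow>
     1 \<le> k \<and> k \<le> n \<and>
     (\<forall>s t. s < t \<and> t < k \<longrightarrow> th t < th s) \<and> th (k - 1) > 0 \<and>
     (\<forall>i<n. v i \<ge> 0) \<and> (\<forall>i<n. B i > 0) \<and> inj_on B {0..<n} \<and>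
     inj_on pr {0..<n}"

definition precedes :: "(nat \<Rightarrow> real) \<Rightarrow> (nat \<Rightarrow> nat) \<Rightarrow> nat \<Rightarrow> nat \<Rightarrow> bool" where
  "precedes b pr j i \<longleftrightarrow> b j > b i \<or> (b j = b i \<and> pr j < pr i)"

definition pos :: "nat \<Rightarrow> (nat \<Rightarrow> real) \<Rightarrow> (nat \<Rightarrow> nat) \<Rightarrow> nat \<Rightarrow> nat" where
  "pos n b pr i = card {j. j < n \<and> precedes b pr j i}"

definition player_at :: "nat \<Rightarrow> (nat \<Rightarrow> real) \<Rightarrow> (nat \<Rightarrow> nat) \<Rightarrow> nat \<Rightarrow> nat" where
  "player_at n b pr m = (THE j. j < n \<and> pos n b pr j = m)"

definition bcp_price :: "nat \<Rightarrow> (nat \<Rightarrow> real) \<Rightarrow> (nat \<Rightarrow> nat) \<Rightarrow> nat \<Rightarrow> real" where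
  "bcp_price n b pr i =
     (if Suc (pos n b pr i) < n then b (player_at n b pr (Suc (pos n b pr i))) else 0)"

text \<open>Slot assignment after processing the first m players of the order.
  Each processed player gets the highest-CTR free slot s (i.e. smallest index, since
  th is strictly decreasing) with th s * price \<le> budget-bid, if any.\<close>
fun bcp_alloc_upto ::
  "nat \<Rightarrow> nat \<Rightarrow> (nat \<Rightarrow> real) \<Rightarrow> (nat \<Rightarrow> real) \<Rightarrow> (nat \<Rightarrow> real) \<Rightarrow> (nat \<Rightarrow> nat)
     \<Rightarrow> nat \<Rightarrow> (nat \<Rightarrow> nat option)" where
  "bcp_alloc_upto k n th b g pr 0 = (\<lambda>_. None)"
| "bcp_alloc_upto k n th b g pr (Suc m) =
     (let A = bcp_alloc_upto k n th b g pr m;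
          i = player_at n b pr m;
          avail = {s. s < k \<and> (\<forall>j. A j \<noteq> Some s) \<and> th s * bcp_price n b pr i \<le> g i}
      in if avail = {} then A else A(i := Some (Min avail)))"

definition bcp_alloc ::
  "nat \<Rightarrow> nat \<Rightarrow> (nat \<Rightarrow> real) \<Rightarrow> (nat \<Rightarrow> real) \<Rightarrow> (nat \<Rightarrow> real) \<Rightarrow> (nat \<Rightarrow> nat)
     \<Rightarrow> nat \<Rightarrow> nat option" where
  "bcp_alloc k n th b g pr = bcp_alloc_upto k n th b g pr n"

definition bcp_utility ::
  "nat \<Rightarrow> nat \<Rightarrow> (nat \<Rightarrow> real) \<Rightarrow> (nat \<Rightarrow> real) \<Rightarrow> (nat \<Rightarrow> real) \<Rightarrow> (nat \<Rightarrow> nat)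
     \<Rightarrow> (nat \<Rightarrow> real) \<Rightarrow> (nat \<Rightarrow> real) \<Rightarrow> nat \<Rightarrow> ereal" where
  "bcp_utility k n th v B pr b g i =
     (case bcp_alloc k n th b g pr i of
        None \<Rightarrow> 0
      | Some s \<Rightarrow>
          (if th s * bcp_price n b pr i \<le> B i
           then ereal (th s * (v i - bcp_price n b pr i)) else -\<infinity>))"

definition bcp_nash ::
  "nat \<Rightarrow> nat \<Rightarrow> (nat \<Rightarrow> real) \<Rightarrow> (nat \<Rightarrow> real) \<Rightarrow> (nat \<Rightarrow> real) \<Rightarrow> (nat \<Rightarrow> nat)
     \<Rightarrow> (nat \<Rightarrow> real) \<Rightarrow> (nat \<Rightarrow> real) \<Rightarrow> bool" where
  "bcp_nash k n th v B pr b g \<longleftrightarrow>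
     (\<forall>i<n. b i \<ge> 0 \<and> g i \<ge> 0) \<and>
     (\<forall>i<n. \<forall>b' g'. b' \<ge> 0 \<and> g' \<ge> 0 \<longrightarrow>
        \<not> (bcp_utility k n th v B pr (b(i := b')) (g(i := g')) i
             > bcp_utility k n th v B pr b g i))"

end

theory Submission
  imports Defs "HOL-Library.Product_Lexorder"
begin

text \<open>Values are so large that any affordable better slot beats any worse one whatever the prices,
  and budgets are so close that a price at which somebody can afford a slot lets everybody afford
  the next one. With as many slots as players, bidding 0 secures some slot for free, so everybody
  is assigned a slot and the worst one goes to the last player. Let \<open>w, x, y, z\<close> be the players of
  an equilibrium in decreasing order of their bids.

  As \<open>z\<close> cannot improve by bidding first or second, slot 1 at the price \<open>b x\<close> exceeds his budget,
  so \<open>w\<close> has slot 1 or 2. As \<open>w\<close> cannot improve by bidding just below \<open>x\<close>, he cannot afford the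
  next better slot at the price \<open>b y\<close>.

  In slot 1 the budget-bid of \<open>w\<close> is exactly what he pays, since otherwise \<open>z\<close> could outbid \<open>x\<close>
  without displacing him, and \<open>z\<close> must lose a tie with \<open>x\<close> for the same reason. If \<open>x\<close> had
  slot 2, he would gain by pushing \<open>w\<close> down or by bidding just below \<open>y\<close>, whose budget-bid is too
  large for \<open>z\<close> to take his slot 0 away. So \<open>x\<close> has slot 0 at a price that \<open>w\<close> cannot afford, and
  \<open>x\<close> has priority over the poorer player \<open>z\<close>, which is impossible if ties favour the smaller
  budget. In slot 2 likewise \<open>w\<close> would gain by bidding just below \<open>y\<close>.\<close>

section \<open>Rankings and prices\<close>

definition ranking :: "nat \<Rightarrow> (nat \<Rightarrow> real) \<Rightarrow> (nat \<Rightarrow> nat) \<Rightarrow> nat list \<Rightarrow> bool" where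
  "ranking n b pr xs \<longleftrightarrow> set xs = {0..<n} \<and> distinct xs \<and> sorted_wrt (precedes b pr) xs"

primrec next_bid :: "(nat \<Rightarrow> real) \<Rightarrow> nat list \<Rightarrow> real" where
  "next_bid b [] = 0"
| "next_bid b (j # ws) = b j"

lemma precedes_iff_less: "precedes b pr i j \<longleftrightarrow> (- b i, pr i) < (- b j, pr j)"
  by (auto simp: precedes_def)

lemma ranking_exists:
  assumes "inj_on pr {0..<n}"
  obtains xs where "ranking n b pr xs"
proof
  define key where "key i = (- b i, pr i)" for i
  let ?xs = "sort_key key [0..<n]"
  have "inj_on key {0..<n}"
    using assms by (auto simp: key_def inj_on_def)
  then have "sorted_wrt (<) (map key ?xs)"
    by (simp add: strict_sorted_iff distinct_map)
  then show "ranking n b pr ?xs"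
    by (simp add: ranking_def sorted_wrt_map precedes_iff_less[abs_def] key_def)
qed

lemma ranking_split_exists:
  assumes "inj_on pr {0..<n}" "i < n"
  obtains us ws where "ranking n b pr (us @ i # ws)"
proof -
  obtain xs where xs: "ranking n b pr xs"
    using ranking_exists[OF assms(1)] .
  then have "i \<in> set xs"
    using assms(2) by (simp add: ranking_def)
  with xs that show thesis
    by (metis split_list)
qed

lemma ranking_iff_successively:
  "ranking n b pr xs \<longleftrightarrow> set xs = {0..<n} \<and> successively (precedes b pr) xs"
proof -
  have "transp (precedes b pr)"
    by (auto simp: transp_def precedes_def)
  moreover have "distinct xs" if "sorted_wrt (precedes b pr) xs"
    using that by (induction xs) (auto simp: precedes_def)
  ultimately show ?thesis
    by (auto simp: ranking_def successively_conv_sorted_wrt)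
qed

lemma ranking_length: "ranking n b pr xs \<Longrightarrow> length xs = n"
  using distinct_card[of xs] by (simp add: ranking_def)

lemma ranking_nonincreasing: "ranking n b pr (us @ i # ws) \<Longrightarrow> j \<in> set ws \<Longrightarrow> b j \<le> b i"
  by (auto simp: ranking_def sorted_wrt_append precedes_def)

lemma ranking_pos:
  assumes "ranking n b pr (us @ i # ws)"
  shows "pos n b pr i = length us"
proof -
  have "{j. j < n \<and> precedes b pr j i} = set us"
  proof (intro equalityI subsetI)
    fix j assume j: "j \<in> {j. j < n \<and> precedes b pr j i}"
    then have "j \<in> set (us @ i # ws)"
      using assms by (simp add: ranking_def)
    then show "j \<in> set us"
      using j assms by (auto simp: ranking_def sorted_wrt_append precedes_iff_less)
  next
    fix j assume "j \<in> set us"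
    then show "j \<in> {j. j < n \<and> precedes b pr j i}"
      using assms by (auto simp: ranking_def sorted_wrt_append)
  qed
  then show ?thesis
    using assms by (simp add: pos_def ranking_def distinct_card)
qed

lemma ranking_player_at:
  assumes "ranking n b pr (us @ i # ws)"
  shows "player_at n b pr (length us) = i"
  unfolding player_at_def
proof (rule the_equality)
  show "i < n \<and> pos n b pr i = length us"
    using assms by (auto simp: ranking_pos ranking_def)
next
  fix j assume j: "j < n \<and> pos n b pr j = length us"
  then have "j \<in> set (us @ i # ws)"
    using assms by (simp add: ranking_def)
  then obtain us' ws' where split: "us @ i # ws = us' @ j # ws'"
    by (meson split_list)
  then have "length us = length us'"
    using j assms ranking_pos by simp
  with split show "j = i"
    by simp
qed

lemma ranking_price:
  assumes "ranking n b pr (us @ i # ws)"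
  shows "bcp_price n b pr i = next_bid b ws"
proof (cases ws)
  case Nil
  then show ?thesis
    using assms ranking_length[OF assms] by (simp add: bcp_price_def ranking_pos)
next
  case (Cons j vs)
  have "player_at n b pr (Suc (length us)) = j"
    using assms ranking_player_at[of n b pr "us @ [i]" j vs] Cons by simp
  then show ?thesis
    using assms ranking_length[OF assms] Cons by (simp add: bcp_price_def ranking_pos)
qed

section \<open>Greedy slot assignment\<close>

definition best_affordable :: "(nat \<Rightarrow> real) \<Rightarrow> nat set \<Rightarrow> real \<Rightarrow> real \<Rightarrow> nat \<Rightarrow> bool" where
  "best_affordable th F p \<gamma> s \<longleftrightarrow> s \<in> F \<and> th s * p \<le> \<gamma> \<and> (\<forall>t\<in>F. t < s \<longrightarrow> \<gamma> < th t * p)"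

lemma best_affordable_unique:
  "best_affordable th F p \<gamma> s \<Longrightarrow> best_affordable th F p \<gamma> t \<Longrightarrow> s = t"
  unfolding best_affordable_def by (metis not_less linorder_neqE_nat)

lemma Collect_best_affordable:
  "best_affordable th F p \<gamma> s \<Longrightarrow> {t. best_affordable th F p \<gamma> t} = {s}"
  using best_affordable_unique by blast

lemma best_affordable_exists:
  assumes "s \<in> F" "th s * p \<le> \<gamma>"
  obtains t where "best_affordable th F p \<gamma> t" "t \<le> s"
proof -
  obtain t where "t \<in> F" "th t * p \<le> \<gamma>" "\<And>u. u < t \<Longrightarrow> \<not> (u \<in> F \<and> th u * p \<le> \<gamma>)"
    using assms exists_least_iff[of "\<lambda>t. t \<in> F \<and> th t * p \<le> \<gamma>"] by blast
  with that[of t] assms show thesis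
    by (force simp: best_affordable_def not_le)
qed

lemma best_affordable_iff_Min:
  assumes "finite F"
  shows "best_affordable th F p \<gamma> s \<longleftrightarrow>
    {s \<in> F. th s * p \<le> \<gamma>} \<noteq> {} \<and> s = Min {s \<in> F. th s * p \<le> \<gamma>}"
proof -
  let ?A = "{s \<in> F. th s * p \<le> \<gamma>}"
  have "best_affordable th F p \<gamma> s \<longleftrightarrow> s \<in> ?A \<and> (\<forall>t\<in>?A. s \<le> t)"
    by (force simp: best_affordable_def not_le)
  moreover have "finite ?A"
    using assms by simp
  ultimately show ?thesis
    using Min_in[of ?A] Min_le[of ?A] Min_eqI[of ?A s] by blast
qed

text \<open>The slots of \<open>F\<close> left over by the players \<open>us\<close>; the players \<open>ws\<close> ranked after them only matter
  for the price of the last of \<open>us\<close>.\<close>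

primrec free_slots ::
  "(nat \<Rightarrow> real) \<Rightarrow> (nat \<Rightarrow> real) \<Rightarrow> (nat \<Rightarrow> real) \<Rightarrow> nat set \<Rightarrow> nat list \<Rightarrow> nat list \<Rightarrow> nat set" where
  "free_slots th b g F [] ws = F"
| "free_slots th b g F (i # us) ws =
     free_slots th b g (F - {s. best_affordable th F (next_bid b (us @ ws)) (g i) s}) us ws"

lemma free_slots_snoc:
  "free_slots th b g F (us @ [i]) ws =
     (let G = free_slots th b g F us (i # ws)
      in G - {s. best_affordable th G (next_bid b ws) (g i) s})"
  by (induction us arbitrary: F) simp_all

lemma free_slots_fun_upd:
  "i \<notin> set us \<Longrightarrow> free_slots th b (g(i := \<gamma>)) F us ws = free_slots th b g F us ws"
  by (induction us arbitrary: F) auto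

lemma free_slots_subset: "free_slots th b g F us ws \<subseteq> F"
  by (induction us arbitrary: F) (simp, fastforce)

lemma card_free_slots:
  assumes "finite F"
  shows "card F \<le> card (free_slots th b g F us ws) + length us"
  using assms
proof (induction us arbitrary: F)
  case (Cons i us)
  let ?T = "{s. best_affordable th F (next_bid b (us @ ws)) (g i) s}"
  have "?T = {} \<or> (\<exists>s. ?T = {s})"
    using Collect_best_affordable by blast
  then have "card F \<le> card (F - ?T) + 1"
    by (elim disjE exE) (simp_all add: card_Diff_singleton_if, arith)
  also have "card (F - ?T) \<le> card (free_slots th b g (F - ?T) us ws) + length us"
    using Cons by simp
  finally show ?case
    by simp
qed simp

declare bcp_alloc_upto.simps(2) [simp del]

lemma bcp_alloc_upto_eq_None:
  assumes "ranking n b pr (us @ ws)" "j \<notin> set us"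
  shows "bcp_alloc_upto k n th b g pr (length us) j = None"
  using assms
  by (induction us arbitrary: ws rule: rev_induct)
    (auto simp: bcp_alloc_upto.simps(2) Let_def ranking_player_at)

lemma bcp_alloc_upto_Suc_eq_Some_iff:
  fixes k th g
  assumes rank: "ranking n b pr (us @ i # ws)"
  defines "A \<equiv> bcp_alloc_upto k n th b g pr"
  shows "A (Suc (length us)) j = Some s \<longleftrightarrow>
    A (length us) j = Some s \<or>
    j = i \<and> best_affordable th {s. s < k \<and> (\<forall>j. A (length us) j \<noteq> Some s)} (next_bid b ws) (g i) s"
proof -
  have "A (length us) i = None"
    unfolding A_def using bcp_alloc_upto_eq_None[OF rank] rank by (simp add: ranking_def)
  then show ?thesis
    by (auto simp: A_def bcp_alloc_upto.simps(2) Let_def ranking_player_at[OF rank]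
        ranking_price[OF rank] best_affordable_iff_Min)
qed

lemma unassigned_slots_eq_free_slots:
  assumes "ranking n b pr (us @ ws)"
  shows "{s. s < k \<and> (\<forall>j. bcp_alloc_upto k n th b g pr (length us) j \<noteq> Some s)} =
    free_slots th b g {..<k} us ws"
  using assms
proof (induction us arbitrary: ws rule: rev_induct)
  case (snoc i us)
  let ?A = "bcp_alloc_upto k n th b g pr"
  let ?F = "{s. s < k \<and> (\<forall>j. ?A (length us) j \<noteq> Some s)}"
  have rank: "ranking n b pr (us @ i # ws)"
    using snoc.prems by simp
  have "{s. s < k \<and> (\<forall>j. ?A (Suc (length us)) j \<noteq> Some s)} =
      ?F - {s. best_affordable th ?F (next_bid b ws) (g i) s}"
    unfolding bcp_alloc_upto_Suc_eq_Some_iff[OF rank] by blast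
  then show ?case
    by (simp add: snoc.IH[OF rank] free_slots_snoc Let_def)
qed auto

lemma bcp_alloc_upto_append:
  assumes "ranking n b pr (us @ vs @ ws)" "j \<in> set us"
  shows "bcp_alloc_upto k n th b g pr (length (us @ vs)) j =
    bcp_alloc_upto k n th b g pr (length us) j"
  using assms
proof (induction vs arbitrary: ws rule: rev_induct)
  case (snoc i vs)
  have rank: "ranking n b pr ((us @ vs) @ i # ws)"
    using snoc.prems by simp
  have "j \<noteq> i"
    using snoc.prems by (auto simp: ranking_def)
  then have "bcp_alloc_upto k n th b g pr (Suc (length (us @ vs))) j = Some s \<longleftrightarrow>
      bcp_alloc_upto k n th b g pr (length (us @ vs)) j = Some s" for s
    unfolding bcp_alloc_upto_Suc_eq_Some_iff[OF rank] by simp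
  then have "bcp_alloc_upto k n th b g pr (Suc (length (us @ vs))) j =
      bcp_alloc_upto k n th b g pr (length (us @ vs)) j"
    by (metis option.exhaust)
  then show ?case
    using snoc by simp
qed simp

lemma bcp_alloc_eq_Some_iff:
  assumes rank: "ranking n b pr (us @ i # ws)"
  shows "bcp_alloc k n th b g pr i = Some s \<longleftrightarrow>
    best_affordable th (free_slots th b g {..<k} us (i # ws)) (next_bid b ws) (g i) s"
proof -
  have "bcp_alloc k n th b g pr i = bcp_alloc_upto k n th b g pr (Suc (length us)) i"
    using bcp_alloc_upto_append[of n b pr "us @ [i]" ws "[]" i] rank ranking_length[OF rank]
    by (simp add: bcp_alloc_def)
  moreover have "bcp_alloc_upto k n th b g pr (length us) i = None"
    using bcp_alloc_upto_eq_None[OF rank] rank by (simp add: ranking_def)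
  ultimately show ?thesis
    by (simp add: bcp_alloc_upto_Suc_eq_Some_iff[OF rank] unassigned_slots_eq_free_slots[OF rank])
qed

lemma bcp_alloc_inj:
  assumes "bcp_alloc k n th b g pr i = Some s" "bcp_alloc k n th b g pr j = Some s"
  shows "i = j"
proof -
  have "i = j" if "bcp_alloc_upto k n th b g pr m i = Some s"
    "bcp_alloc_upto k n th b g pr m j = Some s" for m
    using that
  proof (induction m)
    case (Suc m)
    let ?avail = "{s. s < k \<and> (\<forall>j. bcp_alloc_upto k n th b g pr m j \<noteq> Some s) \<and>
      th s * bcp_price n b pr (player_at n b pr m) \<le> g (player_at n b pr m)}"
    have "Min ?avail \<in> ?avail" if "?avail \<noteq> {}"
      using that by (intro Min_in) auto
    with Suc show ?case
      by (auto simp: bcp_alloc_upto.simps(2) Let_def split: if_splits)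
  qed simp
  with assms show ?thesis
    by (simp add: bcp_alloc_def)
qed

section \<open>Equilibrium conditions\<close>

lemma valid_setting_ctr_pos:
  assumes "valid_setting k n th v B pr" "s < k"
  shows "0 < th s"
proof -
  have "th (k - 1) \<le> th s"
    using assms by (cases "s = k - 1") (auto simp: valid_setting_def intro: less_imp_le)
  then show ?thesis
    using assms by (auto simp: valid_setting_def)
qed

lemma valid_setting_ctr_antimono:
  "valid_setting k n th v B pr \<Longrightarrow> s \<le> t \<Longrightarrow> t < k \<Longrightarrow> th t \<le> th s"
  by (cases "s = t") (auto simp: valid_setting_def intro: less_imp_le)

lemma bcp_nash_next_bid_nonneg:
  assumes "bcp_nash k n th v B pr b g" "set ws \<subseteq> {0..<n}"
  shows "0 \<le> next_bid b ws"
  using assms by (cases ws) (auto simp: bcp_nash_def)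

text \<open>With a budget-bid equal to the cost of a free slot, a player gets that slot or a better one
  that costs no more.\<close>

lemma bcp_utility_exact_budget_bid:
  fixes b ws
  defines "p \<equiv> next_bid b ws"
  assumes valid: "valid_setting k n th v B pr"
    and rank: "ranking n b pr (us @ i # ws)"
    and free: "s \<in> free_slots th b g {..<k} us (i # ws)"
    and affordable: "th s * p \<le> B i"
  shows "ereal (th s * (v i - p)) \<le> bcp_utility k n th v B pr b (g(i := th s * p)) i"
proof -
  obtain t where t: "best_affordable th (free_slots th b g {..<k} us (i # ws)) p (th s * p) t"
    and "t \<le> s"
    using best_affordable_exists[OF free, of th p "th s * p"] by auto
  have cost: "th t * p \<le> th s * p"
    using t by (simp add: best_affordable_def)
  have "i < n" "i \<notin> set us"
    using rank by (auto simp: ranking_def)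
  then have "bcp_alloc k n th b (g(i := th s * p)) pr i = Some t"
    using t by (simp add: bcp_alloc_eq_Some_iff[OF rank] free_slots_fun_upd p_def)
  with cost affordable
  have "bcp_utility k n th v B pr b (g(i := th s * p)) i = ereal (th t * (v i - p))"
    by (simp add: bcp_utility_def ranking_price[OF rank] p_def)
  moreover have "s < k"
    using free free_slots_subset by fastforce
  then have "th s * v i \<le> th t * v i"
    using valid \<open>t \<le> s\<close> \<open>i < n\<close>
    by (intro mult_right_mono valid_setting_ctr_antimono[OF valid]) (auto simp: valid_setting_def)
  ultimately show ?thesis
    using cost by (simp add: right_diff_distrib)
qed

lemma nash_deviation:
  assumes valid: "valid_setting k n th v B pr" and nash: "bcp_nash k n th v B pr b g"
    and rank: "ranking n (b(i := \<beta>)) pr (us @ i # ws)" and "0 \<le> \<beta>"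
    and free: "s \<in> free_slots th (b(i := \<beta>)) g {..<k} us (i # ws)"
    and affordable: "th s * next_bid b ws \<le> B i"
  shows "ereal (th s * (v i - next_bid b ws)) \<le> bcp_utility k n th v B pr b g i"
proof -
  let ?p = "next_bid b ws"
  have others: "i < n" "i \<notin> set ws" "set ws \<subseteq> {0..<n}"
    using rank by (auto simp: ranking_def)
  then have next_bid: "next_bid (b(i := \<beta>)) ws = ?p"
    by (cases ws) auto
  have "0 < th s"
    using valid_setting_ctr_pos[OF valid] free free_slots_subset by fastforce
  then have "0 \<le> th s * ?p"
    using bcp_nash_next_bid_nonneg[OF nash others(3)] by simp
  have "ereal (th s * (v i - ?p)) \<le> bcp_utility k n th v B pr (b(i := \<beta>)) (g(i := th s * ?p)) i"
    using bcp_utility_exact_budget_bid[OF valid rank free] affordable by (simp add: next_bid)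
  also have "\<dots> \<le> bcp_utility k n th v B pr b g i"
    using nash \<open>i < n\<close> \<open>0 \<le> \<beta>\<close> \<open>0 \<le> th s * ?p\<close> by (simp add: bcp_nash_def not_less)
  finally show ?thesis .
qed

lemma nash_utility_ge_last_slot:
  assumes valid: "valid_setting n n th v B pr" and nash: "bcp_nash n n th v B pr b g" and "i < n"
  shows "ereal (th (n - 1) * v i) \<le> bcp_utility n n th v B pr b g i"
proof -
  have "inj_on pr {0..<n}"
    using valid by (simp add: valid_setting_def)
  then obtain us ws where rank: "ranking n (b(i := 0)) pr (us @ i # ws)"
    using \<open>i < n\<close> by (rule ranking_split_exists)
  then have others: "set ws \<subseteq> {0..<n}" "i \<notin> set ws"
    by (auto simp: ranking_def)
  have "next_bid b ws \<le> 0"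
    using ranking_nonincreasing[OF rank, of "hd ws"] others(2) by (cases ws) auto
  then have price: "next_bid b ws = 0"
    using bcp_nash_next_bid_nonneg[OF nash others(1)] by simp
  have "length us < n"
    using ranking_length[OF rank] by simp
  then have "free_slots th (b(i := 0)) g {..<n} us (i # ws) \<noteq> {}"
    using card_free_slots[of "{..<n}" th "b(i := 0)" g us "i # ws"] by auto
  then obtain s where free: "s \<in> free_slots th (b(i := 0)) g {..<n} us (i # ws)"
    by auto
  then have "th (n - 1) \<le> th s"
    using free_slots_subset by (intro valid_setting_ctr_antimono[OF valid]) fastforce+
  then have "ereal (th (n - 1) * v i) \<le> ereal (th s * v i)"
    using valid \<open>i < n\<close> by (auto simp: valid_setting_def intro: mult_right_mono)
  also have "\<dots> \<le> bcp_utility n n th v B pr b g i"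
    using nash_deviation[OF valid nash rank _ free] valid \<open>i < n\<close>
    by (simp add: price valid_setting_def less_imp_le)
  finally show ?thesis .
qed

locale budget_bound_equilibrium =
  fixes n :: nat and th v B :: "nat \<Rightarrow> real" and pr :: "nat \<Rightarrow> nat" and b g :: "nat \<Rightarrow> real"
  assumes valid: "valid_setting n n th v B pr"
    and two_slots: "2 \<le> n"
    and budget_less_slot_gain: "i < n \<Longrightarrow> Suc s < n \<Longrightarrow> B i < (th s - th (Suc s)) * v i"
    and nash: "bcp_nash n n th v B pr b g"
begin

definition slot :: "nat \<Rightarrow> nat" where
  "slot i = the (bcp_alloc n n th b g pr i)"

abbreviation price :: "nat \<Rightarrow> real" where
  "price \<equiv> bcp_price n b pr"

abbreviation utility :: "nat \<Rightarrow> ereal" where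
  "utility \<equiv> bcp_utility n n th v B pr b g"

lemma bid_nonneg: "i < n \<Longrightarrow> 0 \<le> b i" and budget_bid_nonneg: "i < n \<Longrightarrow> 0 \<le> g i"
  using nash by (auto simp: bcp_nash_def)

lemma budget_pos: "i < n \<Longrightarrow> 0 < B i" and value_nonneg: "i < n \<Longrightarrow> 0 \<le> v i"
  using valid by (auto simp: valid_setting_def)

lemmas ctr_pos = valid_setting_ctr_pos[OF valid]

lemmas ctr_antimono = valid_setting_ctr_antimono[OF valid]

lemma value_pos: "i < n \<Longrightarrow> 0 < v i"
  using budget_less_slot_gain[of i 0] budget_pos[of i] value_nonneg[of i] two_slots
  by (cases "v i = 0") auto

lemma pr_inj: "inj_on pr {0..<n}"
  using valid by (simp add: valid_setting_def)

lemma price_nonneg: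
  assumes "i < n"
  shows "0 \<le> price i"
proof -
  obtain us ws where rank: "ranking n b pr (us @ i # ws)"
    using ranking_split_exists[OF pr_inj assms] .
  then have "set ws \<subseteq> {0..<n}"
    by (auto simp: ranking_def)
  then show ?thesis
    using bcp_nash_next_bid_nonneg[OF nash] by (simp add: ranking_price[OF rank])
qed

lemma
  assumes "i < n"
  shows alloc_eq_slot: "bcp_alloc n n th b g pr i = Some (slot i)"
    and slot_affordable: "th (slot i) * price i \<le> B i"
    and utility_eq: "utility i = ereal (th (slot i) * (v i - price i))"
proof -
  have "0 < th (n - 1) * v i"
    using two_slots ctr_pos[of "n - 1"] value_pos[OF assms] by simp
  with nash_utility_ge_last_slot[OF valid nash assms] have "0 < utility i"
    by (metis ereal_less(2) less_le_trans)
  then show "bcp_alloc n n th b g pr i = Some (slot i)" "th (slot i) * price i \<le> B i"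
    "utility i = ereal (th (slot i) * (v i - price i))"
    by (auto simp: bcp_utility_def slot_def split: option.splits if_splits)
qed

lemma slot_takes:
  assumes "ranking n b pr (us @ i # ws)"
  shows "best_affordable th (free_slots th b g {..<n} us (i # ws)) (next_bid b ws) (g i) (slot i)"
proof -
  have "i < n"
    using assms by (auto simp: ranking_def)
  then show ?thesis
    using alloc_eq_slot bcp_alloc_eq_Some_iff[OF assms] by blast
qed

lemma slot_less:
  assumes "i < n"
  shows "slot i < n"
proof -
  obtain us ws where "ranking n b pr (us @ i # ws)"
    using ranking_split_exists[OF pr_inj assms] .
  then have "slot i \<in> free_slots th b g {..<n} us (i # ws)"
    using slot_takes by (simp add: best_affordable_def)
  then show ?thesis
    using free_slots_subset by fastforce
qed

lemma slot_inj: "inj_on slot {..<n}"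
  using alloc_eq_slot bcp_alloc_inj by (metis inj_onI lessThan_iff)

lemma better_slot_preferred:
  assumes "i < n" "s < t" "t < n" "th s * p \<le> B i" "0 \<le> q"
  shows "th t * (v i - q) < th s * (v i - p)"
proof -
  have "th t * (v i - q) \<le> th t * v i"
    using assms ctr_pos[of t] by simp
  also have "\<dots> \<le> th (Suc s) * v i"
    using assms ctr_antimono[of "Suc s" t] value_nonneg by (intro mult_right_mono) auto
  also have "\<dots> < th s * v i - B i"
    using assms budget_less_slot_gain[of i s] by (simp add: left_diff_distrib)
  also have "\<dots> \<le> th s * (v i - p)"
    using assms by (simp add: right_diff_distrib)
  finally show ?thesis .
qed

lemma no_profitable_deviation:
  assumes rank: "ranking n (b(i := \<beta>)) pr (us @ i # ws)" and "0 \<le> \<beta>"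
    and free: "s \<in> free_slots th (b(i := \<beta>)) g {..<n} us (i # ws)"
    and affordable: "th s * next_bid b ws \<le> B i"
  shows "slot i \<le> s" and "slot i = s \<Longrightarrow> price i \<le> next_bid b ws"
proof -
  have "i < n"
    using rank by (auto simp: ranking_def)
  have "s < n"
    using free free_slots_subset by fastforce
  have utility: "th s * (v i - next_bid b ws) \<le> th (slot i) * (v i - price i)"
    using nash_deviation[OF valid nash assms] by (simp add: utility_eq[OF \<open>i < n\<close>])
  show "slot i \<le> s"
  proof (rule ccontr)
    assume "\<not> slot i \<le> s"
    then show False
      using utility better_slot_preferred[of i s "slot i" "next_bid b ws" "price i"]
        \<open>i < n\<close> affordable slot_less price_nonneg by auto
  qed
  show "price i \<le> next_bid b ws" if "slot i = s"
    using utility ctr_pos[OF \<open>s < n\<close>] that by simp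
qed

lemma no_profitable_move_to_second:
  assumes rank: "ranking n (b(i := \<beta>)) pr (j # i # ws)" and "0 \<le> \<beta>" and "s \<noteq> t"
    and slots: "\<And>r. r \<in> {s, t} \<Longrightarrow> r < n \<and> th r * next_bid b ws \<le> B i"
  shows "\<exists>r\<in>{s, t}. slot i \<le> r \<and> (slot i = r \<longrightarrow> price i \<le> next_bid b ws)"
proof -
  obtain r where r: "r \<in> {s, t}" "\<not> best_affordable th {..<n} \<beta> (g j) r"
    using best_affordable_unique \<open>s \<noteq> t\<close> by (metis insertI1 insertI2)
  have "j \<noteq> i"
    using rank by (auto simp: ranking_def)
  then have "r \<in> free_slots th (b(i := \<beta>)) g {..<n} [j] (i # ws)"
    using r slots by simp
  then have "slot i \<le> r \<and> (slot i = r \<longrightarrow> price i \<le> next_bid b ws)"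
    using no_profitable_deviation[of i \<beta> "[j]" ws r] rank \<open>0 \<le> \<beta>\<close> slots r(1) by simp
  with r(1) show ?thesis
    by blast
qed

lemma no_profitable_move_to_third:
  assumes rank: "ranking n (b(i := \<beta>)) pr (j # k # i # ws)" and "0 \<le> \<beta>"
    and j_takes: "best_affordable th {..<n} (b k) (g j) s"
    and k_takes: "best_affordable th ({..<n} - {s}) \<beta> (g k) t"
    and "r < n" "r \<noteq> s" "r \<noteq> t" and affordable: "th r * next_bid b ws \<le> B i"
  shows "slot i \<le> r" and "slot i = r \<Longrightarrow> price i \<le> next_bid b ws"
proof -
  have "k \<noteq> i"
    using rank by (auto simp: ranking_def)
  then have "r \<in> free_slots th (b(i := \<beta>)) g {..<n} [j, k] (i # ws)"
    using assms by (simp add: Collect_best_affordable)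
  then show "slot i \<le> r" "slot i = r \<Longrightarrow> price i \<le> next_bid b ws"
    using no_profitable_deviation[of i \<beta> "[j, k]" ws r] rank \<open>0 \<le> \<beta>\<close> affordable by simp_all
qed

lemma price_last_slot:
  assumes "i < n" "slot i = n - 1"
  shows "price i = 0"
proof -
  have "th (n - 1) * v i \<le> th (n - 1) * (v i - price i)"
    using nash_utility_ge_last_slot[OF valid nash assms(1)] utility_eq[OF assms(1)] assms(2)
    by simp
  then show ?thesis
    using ctr_pos[of "n - 1"] assms(1) price_nonneg[OF assms(1)]
    by (simp add: mult_le_cancel_left)
qed

lemma last_player_gets_last_slot:
  assumes rank: "ranking n b pr (us @ [z])"
  shows "slot z = n - 1"
proof -
  have "slot ` {..<n} = {..<n}"
    using slot_inj slot_less by (intro endo_inj_surj) auto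
  then have "n - 1 \<in> slot ` {..<n}"
    using two_slots by simp
  then obtain i where i: "i < n" "slot i = n - 1"
    by auto
  obtain us' ws where rank': "ranking n b pr (us' @ i # ws)"
    using ranking_split_exists[OF pr_inj i(1)] .
  let ?F = "free_slots th b g {..<n} us' (i # ws)"
  have "next_bid b ws = 0"
    using price_last_slot[OF i] by (simp add: ranking_price[OF rank'])
  then have "\<not> t < n - 1" if "t \<in> ?F" for t
    using slot_takes[OF rank'] budget_bid_nonneg[OF i(1)] that i(2)
    by (auto simp: best_affordable_def)
  then have "?F \<subseteq> {n - 1}"
    using free_slots_subset[of th b g "{..<n}" us' "i # ws"] by fastforce
  then have "card ?F \<le> 1"
    using card_mono[of "{n - 1}" ?F] by simp
  then have "n \<le> Suc (length us')"
    using card_free_slots[of "{..<n}" th b g us' "i # ws"] by simp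
  then have "length us' = length us"
    using ranking_length[OF rank] ranking_length[OF rank'] by simp
  then have "z = i"
    using ranking_player_at[OF rank] ranking_player_at[OF rank'] by simp
  then show ?thesis
    using i(2) by simp
qed

end

section \<open>Four players with close budgets\<close>

locale four_player_equilibrium = budget_bound_equilibrium 4 th v B pr b g
  for th v B :: "nat \<Rightarrow> real" and pr :: "nat \<Rightarrow> nat" and b g :: "nat \<Rightarrow> real" +
  fixes w x y z :: nat
  assumes close_budgets: "i < 4 \<Longrightarrow> j < 4 \<Longrightarrow> Suc s < 4 \<Longrightarrow> th (Suc s) * B i < th s * B j"
    and rank: "ranking 4 b pr [w, x, y, z]"
begin

lemma players: "w < 4" "x < 4" "y < 4" "z < 4"
  using rank by (auto simp: ranking_def)

lemma players_distinct: "distinct [w, x, y, z]"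
  using rank by (simp add: ranking_def)

lemma player_order: "precedes b pr w x" "precedes b pr x y" "precedes b pr y z"
  using rank by (simp_all add: ranking_def)

lemma bids_ordered: "b x \<le> b w" "b y \<le> b x" "b z \<le> b y" "0 \<le> b z"
  using player_order bid_nonneg[OF players(4)] by (auto simp: precedes_def)

lemma prices: "price w = b x" "price x = b y" "price y = b z"
  using ranking_price[of 4 b pr "[]" w "[x, y, z]"] ranking_price[of 4 b pr "[w]" x "[y, z]"]
    ranking_price[of 4 b pr "[w, x]" y "[z]"] rank by simp_all

lemma slot_z: "slot z = 3"
  using last_player_gets_last_slot[of "[w, x, y]" z] rank by simp

lemma slots_distinct: "slot x \<noteq> slot w" "slot y \<noteq> slot w" "slot y \<noteq> slot x"
  using players players_distinct by (simp_all add: inj_on_eq_iff[OF slot_inj])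

lemma slots_less: "slot w < 3" "slot x < 3" "slot y < 3"
proof -
  have "slot i < 3" if "i < 4" "i \<noteq> z" for i
    using that slot_less[of i] players(4) slot_z inj_on_eq_iff[OF slot_inj, of i z] by simp
  then show "slot w < 3" "slot x < 3" "slot y < 3"
    using players players_distinct by simp_all
qed

lemma slots_affordable:
  "th (slot w) * b x \<le> B w" "th (slot x) * b y \<le> B x" "th (slot y) * b z \<le> B y"
  using slot_affordable[OF players(1)] slot_affordable[OF players(2)] slot_affordable[OF players(3)]
  by (simp_all add: prices)

lemma w_takes: "best_affordable th {..<4} (b x) (g w) (slot w)"
  using slot_takes[of "[]" w "[x, y, z]"] rank by simp

lemma x_takes: "best_affordable th ({..<4} - {slot w}) (b y) (g x) (slot x)"
  using slot_takes[of "[w]" x "[y, z]"] rank by (simp add: Collect_best_affordable[OF w_takes])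

lemma y_takes: "best_affordable th ({..<4} - {slot w} - {slot x}) (b z) (g y) (slot y)"
  using slot_takes[of "[w, x]" y "[z]"] rank
  by (simp add: Collect_best_affordable[OF w_takes] Collect_best_affordable[OF x_takes])

lemma worse_slot_affordable:
  assumes "th s * p \<le> B i" "s < t" "t < 4" "i < 4" "j < 4"
  shows "th t * p < B j"
proof -
  have pos: "0 < th s" "0 < th t"
    using assms ctr_pos by auto
  have "th s * (th t * p) \<le> th t * B i"
    using assms(1) pos by (simp add: mult.left_commute)
  also have "\<dots> \<le> th (Suc s) * B i"
    using assms ctr_antimono budget_pos by (intro mult_right_mono) (auto intro: less_imp_le)
  also have "\<dots> < th s * B j"
    using assms by (intro close_budgets) auto
  finally show ?thesis
    using pos by simp
qed

lemma ranking_reorder: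
  "set ys = {w, x, y, z} \<Longrightarrow> successively (precedes b' pr) ys \<Longrightarrow> ranking 4 b' pr ys"
  using rank by (simp add: ranking_iff_successively)

lemma ranking_z_second:
  "b x < \<beta> \<Longrightarrow> \<beta> < b w \<Longrightarrow> ranking 4 (b(z := \<beta>)) pr [w, z, x, y]"
  by (rule ranking_reorder; use player_order players_distinct in \<open>auto simp: precedes_def\<close>)

lemma budget_z_less_slot_2_at_bid_w: "B z < th 2 * b w"
proof (rule ccontr)
  assume affordable: "\<not> ?thesis"
  have "ranking 4 (b(z := b w + 1)) pr [z, w, x, y]"
    by (rule ranking_reorder; use player_order players_distinct in \<open>auto simp: precedes_def\<close>)
  then have "slot z \<le> 2"
    using no_profitable_deviation(1)[of z "b w + 1" "[]" "[w, x, y]" 2] affordable bids_ordered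
    by simp
  then show False
    by (simp add: slot_z)
qed

lemma budget_z_less_slot_1_at_bid_x: "B z < th 1 * b x"
proof (rule ccontr)
  assume "\<not> ?thesis"
  then have affordable: "th 1 * b x \<le> B z" "th 2 * b x \<le> B z"
    using worse_slot_affordable[of 1 "b x" z 2 z] players by auto
  then have "th 2 * b x < th 2 * b w"
    using budget_z_less_slot_2_at_bid_w by simp
  then obtain \<beta> where \<beta>: "b x < \<beta>" "\<beta> < b w"
    using ctr_pos[of 2] dense by auto
  have "\<exists>r\<in>{1, 2}. slot z \<le> r \<and> (slot z = r \<longrightarrow> price z \<le> next_bid b [x, y])"
    using \<beta> bids_ordered affordable
    by (intro no_profitable_move_to_second[OF ranking_z_second[OF \<beta>]]) auto
  then show False
    by (auto simp: slot_z)
qed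

lemma slot_w_cases: "slot w = 1 \<or> slot w = 2"
proof -
  have "slot w \<noteq> 0"
  proof
    assume "slot w = 0"
    then have "th 1 * b x < B z"
      using slots_affordable(1) worse_slot_affordable[of 0 "b x" w 1 z] players by simp
    with budget_z_less_slot_1_at_bid_x show False
      by simp
  qed
  then show ?thesis
    using slots_less(1) by auto
qed

lemma slot_2_affordable_at_bid_x:
  assumes "slot w = 1" "i < 4"
  shows "th 2 * b x < B i"
  using assms slots_affordable(1) worse_slot_affordable[of 1 "b x" w 2 i] players by simp

lemma bid_x_less_bid_w:
  assumes "slot w = 1"
  shows "b x < b w"
proof -
  have "th 2 * b x < th 2 * b w"
    using slot_2_affordable_at_bid_x[OF assms players(4)] budget_z_less_slot_2_at_bid_w by simp
  then show ?thesis
    using ctr_pos[of 2] by simp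
qed

lemma z_second_displaces_w:
  assumes "slot w = 1" "ranking 4 (b(z := \<beta>)) pr [w, z, x, y]" "0 \<le> \<beta>"
  shows "\<not> best_affordable th {..<4} \<beta> (g w) 1"
proof
  assume "best_affordable th {..<4} \<beta> (g w) 1"
  then have "2 \<in> free_slots th (b(z := \<beta>)) g {..<4} [w] [z, x, y]"
    using players_distinct by (simp add: Collect_best_affordable)
  then have "slot z \<le> 2"
    using no_profitable_deviation(1)[of z \<beta> "[w]" "[x, y]" 2] assms
      slot_2_affordable_at_bid_x[OF assms(1) players(4)] by simp
  then show False
    by (simp add: slot_z)
qed

lemma budget_bid_w_eq:
  assumes "slot w = 1"
  shows "g w = th 1 * b x"
proof (rule ccontr)
  have pos: "0 < th 0" "0 < th 1"
    using ctr_pos by simp_all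
  have w: "th 1 * b x \<le> g w" "g w < th 0 * b x"
    using w_takes assms by (auto simp: best_affordable_def)
  assume "g w \<noteq> th 1 * b x"
  then have "b x < min (b w) (g w / th 1)"
    using w bid_x_less_bid_w[OF assms] pos by (simp add: field_simps)
  then obtain \<beta> where \<beta>: "b x < \<beta>" "\<beta> < b w" "\<beta> < g w / th 1"
    using dense by (metis min_less_iff_conj)
  have "g w < th 0 * \<beta>"
    using w(2) \<beta>(1) pos by (smt (verit) mult_left_mono)
  then have "best_affordable th {..<4} \<beta> (g w) 1"
    using \<beta>(3) pos by (simp add: best_affordable_def field_simps)
  moreover have "ranking 4 (b(z := \<beta>)) pr [w, z, x, y]"
    using \<beta>(1,2) by (rule ranking_z_second)
  ultimately show False
    using z_second_displaces_w[OF assms] \<beta> bids_ordered by simp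
qed

lemma priority_x_z:
  assumes "slot w = 1"
  shows "pr x < pr z"
proof (rule ccontr)
  assume "\<not> pr x < pr z"
  moreover have "pr x \<noteq> pr z"
    using players players_distinct by (simp add: inj_on_eq_iff[OF pr_inj])
  ultimately have "pr z < pr x"
    by simp
  have "ranking 4 (b(z := b x)) pr [w, z, x, y]"
    by (rule ranking_reorder; use player_order players_distinct bid_x_less_bid_w[OF assms]
        \<open>pr z < pr x\<close> in \<open>auto simp: precedes_def\<close>)
  then show False
    using z_second_displaces_w[OF assms] w_takes assms bids_ordered by simp
qed

lemma slot_w_le_if_affordable_at_bid_y:
  assumes "Suc s < 4" "th s * b y \<le> B w"
  shows "slot w \<le> s"
proof (cases "b y < b x")
  case True
  then obtain \<beta> where \<beta>: "b y < \<beta>" "\<beta> < b x"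
    using dense by auto
  have w_second: "ranking 4 (b(w := \<beta>)) pr [x, w, y, z]"
    by (rule ranking_reorder; use player_order players_distinct \<beta> in \<open>auto simp: precedes_def\<close>)
  have "th (Suc s) * b y \<le> B w"
    using worse_slot_affordable[of s "b y" w "Suc s" w] assms players by simp
  then have "\<exists>r\<in>{s, Suc s}. slot w \<le> r \<and> (slot w = r \<longrightarrow> price w \<le> next_bid b [y, z])"
    using \<beta> bids_ordered assms by (intro no_profitable_move_to_second[OF w_second]) auto
  then show ?thesis
    using True by (auto simp: prices)
next
  case False
  then have "b x = b y"
    using bids_ordered by simp
  then show ?thesis
    using no_profitable_deviation(1)[of w "b w" "[]" "[x, y, z]" s] rank bids_ordered assms by simp
qed

lemma slot_x_le_1_if_affordable_at_bid_y:
  assumes "slot w = 1" "th 1 * b y \<le> B x"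
  shows "slot x \<le> 1"
proof -
  obtain \<beta> where \<beta>: "b x < \<beta>" "\<beta> < b w"
    using bid_x_less_bid_w[OF assms(1)] dense by auto
  then have "g w < th 1 * \<beta>"
    using budget_bid_w_eq[OF assms(1)] ctr_pos[of 1] by simp
  then have "\<not> best_affordable th {..<4} \<beta> (g w) 1"
    by (simp add: best_affordable_def)
  moreover have "ranking 4 (b(x := \<beta>)) pr [w, x, y, z]"
    by (rule ranking_reorder; use player_order players_distinct \<beta> in \<open>auto simp: precedes_def\<close>)
  ultimately show ?thesis
    using no_profitable_deviation(1)[of x \<beta> "[w]" "[y, z]" 1] assms(2) \<beta> bids_ordered
      players_distinct by simp
qed

lemma slot_y_at_bid_y_le_budget_bid_y: "th (slot y) * b y \<le> g y"
proof (rule ccontr)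
  have "0 < th (slot y)"
    using ctr_pos slots_less(3) by simp
  moreover have "th (slot y) * b z \<le> g y"
    using y_takes by (simp add: best_affordable_def)
  moreover assume "\<not> ?thesis"
  ultimately have "b z \<le> g y / th (slot y)" "g y / th (slot y) < b y"
    by (simp_all add: field_simps)
  then obtain \<beta> where "g y / th (slot y) < \<beta>" and \<beta>: "b z < \<beta>" "\<beta> < b y"
    using dense[of "g y / th (slot y)" "b y"] by force
  then have "g y < th (slot y) * \<beta>"
    using \<open>0 < th (slot y)\<close> by (simp add: field_simps)
  then have "\<not> best_affordable th ({..<4} - {slot w} - {slot x}) \<beta> (g y) (slot y)"
    by (simp add: best_affordable_def)
  then have "slot y \<in> free_slots th (b(z := \<beta>)) g {..<4} [w, x, y] [z]"
    using slots_less(3) slots_distinct(2,3) players_distinct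
    by (simp add: Collect_best_affordable[OF w_takes] Collect_best_affordable[OF x_takes])
  moreover have "ranking 4 (b(z := \<beta>)) pr [w, x, y, z]"
    by (rule ranking_reorder; use player_order players_distinct \<beta> in \<open>auto simp: precedes_def\<close>)
  ultimately have "slot z \<le> slot y"
    using no_profitable_deviation(1)[of z \<beta> "[w, x, y]" "[]" "slot y"] \<beta> bids_ordered
      budget_pos[OF players(4)] by simp
  then show False
    using slots_less(3) by (simp add: slot_z)
qed

lemma slot_x_neq_2:
  assumes w: "slot w = 1"
  shows "slot x \<noteq> 2"
proof
  assume x: "slot x = 2"
  have y: "slot y = 0"
    using w x slots_distinct slots_less(3) by arith
  have pos: "0 < th 0" "0 < th 1"
    using ctr_pos by simp_all
  have bid_y: "B x < th 1 * b y"
    using slot_x_le_1_if_affordable_at_bid_y[OF w] x by force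
  then have "th 1 * b z < th 1 * b y"
    using slots_affordable(3) y worse_slot_affordable[of 0 "b z" y 1 x] players by simp
  then obtain \<beta> where \<beta>: "b z < \<beta>" "\<beta> < b y"
    using pos dense by auto
  have "B w < th 0 * b y"
    using bid_y worse_slot_affordable[of 0 "b y" w 1 x] players by force
  moreover have "th 1 * b y \<le> th 1 * b x"
    using bids_ordered pos by simp
  ultimately have w_takes_1: "best_affordable th {..<4} (b y) (g w) 1"
    using budget_bid_w_eq[OF w] slots_affordable(1) w by (simp add: best_affordable_def)
  have "th 0 * \<beta> \<le> g y"
    using slot_y_at_bid_y_le_budget_bid_y y \<beta> pos by (smt (verit) mult_left_mono)
  then have y_takes_0: "best_affordable th ({..<4} - {1}) \<beta> (g y) 0"
    by (simp add: best_affordable_def)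
  have "ranking 4 (b(x := \<beta>)) pr [w, y, x, z]"
    by (rule ranking_reorder; use player_order players_distinct bid_x_less_bid_w[OF w] \<beta>
        in \<open>auto simp: precedes_def\<close>)
  moreover have "th 2 * b z \<le> B x"
    using slots_affordable(3) y worse_slot_affordable[of 0 "b z" y 2 x] players by simp
  ultimately have "price x \<le> b z"
    using no_profitable_move_to_third(2)[OF _ _ w_takes_1 y_takes_0, of x "[z]" 2] x \<beta>
      bids_ordered by simp
  with \<beta> show False
    by (simp add: prices)
qed

lemma slot_w_neq_2: "slot w \<noteq> 2"
proof
  assume w: "slot w = 2"
  have bid_y: "B w < th 1 * b y"
    using slot_w_le_if_affordable_at_bid_y[of 1] w by force
  have "slot x \<noteq> 0"
  proof
    assume "slot x = 0"
    then have "th 1 * b y < B w"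
      using slots_affordable(2) worse_slot_affordable[of 0 "b y" x 1 w] players by simp
    with bid_y show False
      by simp
  qed
  then have x: "slot x = 1"
    using w slots_distinct slots_less(2) by arith
  then have y: "slot y = 0"
    using w slots_distinct slots_less(3) by arith
  have pos: "0 < th 0" "0 < th 1"
    using ctr_pos by simp_all
  have "th 1 * b z < th 1 * b y"
    using slots_affordable(3) y worse_slot_affordable[of 0 "b z" y 1 w] players bid_y by simp
  then obtain \<beta> where \<beta>: "b z < \<beta>" "\<beta> < b y"
    using pos dense by auto
  have x_takes_1: "best_affordable th {..<4} (b y) (g x) 1"
    using x_takes w x by (simp add: best_affordable_def)
  have "th 0 * \<beta> \<le> g y"
    using slot_y_at_bid_y_le_budget_bid_y y \<beta> pos by (smt (verit) mult_left_mono)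
  then have y_takes_0: "best_affordable th ({..<4} - {1}) \<beta> (g y) 0"
    by (simp add: best_affordable_def)
  have "ranking 4 (b(w := \<beta>)) pr [x, y, w, z]"
    by (rule ranking_reorder; use player_order players_distinct \<beta> in \<open>auto simp: precedes_def\<close>)
  moreover have "th 2 * b z \<le> B w"
    using slots_affordable(3) y worse_slot_affordable[of 0 "b z" y 2 w] players by simp
  ultimately have "price w \<le> b z"
    using no_profitable_move_to_third(2)[OF _ _ x_takes_1 y_takes_0, of w "[z]" 2] w \<beta>
      bids_ordered by simp
  with \<beta> bids_ordered show False
    by (simp add: prices)
qed

lemma second_richer_than_last: "B z < B x"
  and second_before_last: "pr x < pr z"
proof -
  have w: "slot w = 1"
    using slot_w_cases slot_w_neq_2 by simp
  then show "pr x < pr z"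
    by (rule priority_x_z)
  have "slot x = 0"
    using slot_x_neq_2[OF w] w slots_distinct slots_less(2) by arith
  then have "B w < B x"
    using slots_affordable(2) slot_w_le_if_affordable_at_bid_y[of 0] w by force
  moreover have "B z < B w"
    using budget_z_less_slot_1_at_bid_x slots_affordable(1) w by simp
  ultimately show "B z < B x"
    by simp
qed

end

lemma no_nash_if_poorer_first:
  assumes valid: "valid_setting 4 4 th v B pr"
    and budget_less_slot_gain:
      "\<And>i s. i < 4 \<Longrightarrow> Suc s < 4 \<Longrightarrow> B i < (th s - th (Suc s)) * v i"
    and close_budgets:
      "\<And>i j s. i < 4 \<Longrightarrow> j < 4 \<Longrightarrow> Suc s < 4 \<Longrightarrow> th (Suc s) * B i < th s * B j"
    and poorer_first: "\<And>i j. i < 4 \<Longrightarrow> j < 4 \<Longrightarrow> B i < B j \<Longrightarrow> pr i < pr j"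
  shows "\<not> bcp_nash 4 4 th v B pr b g"
proof
  assume nash: "bcp_nash 4 4 th v B pr b g"
  obtain xs where xs: "ranking 4 b pr xs"
    using valid ranking_exists by (metis valid_setting_def)
  then obtain w x y z where "xs = [w, x, y, z]"
    using ranking_length[OF xs] by (auto simp: numeral_eq_Suc length_Suc_conv)
  with xs nash valid budget_less_slot_gain close_budgets
  interpret four_player_equilibrium th v B pr b g w x y z
    by unfold_locales auto
  have "pr z < pr x"
    using poorer_first second_richer_than_last players by simp
  with second_before_last show False
    by simp
qed

theorem theorem2:
  shows "\<exists>k n th v B pr. valid_setting k n th v B pr \<and>
           \<not> (\<exists>b g. bcp_nash k n th v B pr b g)"
proof -
  define th :: "nat \<Rightarrow> real" where "th s = 4 - real s" for s
  define B :: "nat \<Rightarrow> real" where "B i = 100 + real i" for i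
  have valid: "valid_setting 4 4 th (\<lambda>_. 1000) B id"
    by (auto simp: valid_setting_def th_def B_def inj_on_def)
  have "\<not> bcp_nash 4 4 th (\<lambda>_. 1000) B id b g" for b g
  proof (rule no_nash_if_poorer_first[OF valid])
    show "B i < (th s - th (Suc s)) * 1000" if "i < 4" for i s
      using that by (simp add: th_def B_def)
    show "th (Suc s) * B i < th s * B j" if "i < 4" "j < 4" "Suc s < 4" for i j s
    proof -
      have "s = 0 \<or> s = 1 \<or> s = 2"
        using that(3) by auto
      then show ?thesis
        using that(1,2) by (auto simp: th_def B_def)
    qed
    show "id i < id j" if "B i < B j" for i j
      using that by (simp add: B_def)
  qed
  with valid show ?thesis
    by blast
qed

end
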